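(* Let $m$ be a positive integer and $p$ a prime with $p>m$. Write $p=qm+r$ with $q=\lfloor p/m\rfloor$ and $0\le r<m$, write $\Phi_m=\sum_s a_sx^s$, and let $\Psi_m=(x^m-1)/\Phi_m$. Define $f_{m,p,i}$ ($0\le i\le\varphi(m)-1$) and $f_{m,p,i,j}$ ($0\le j\le q$) by $$\Phi_{mp}=\sum_{i=0}^{\varphi(m)-1}f_{m,p,i}\,x^{ip},\ \deg f_{m,p,i}<p,\qquad f_{m,p,i}=\sum_{j=0}^{q}f_{m,p,i,j}\,x^{jm},\ \deg f_{m,p,i,j}<m.$$ For $0\le i\le\varphi(m)-1$ let $w_i(x)=-\sum_{s=0}^{i}a_sx^{i-s}$ and $\Theta_i=\operatorname{rem}\bigl(w_i(x^{m-r}),\Phi_m\bigr)$. Then for every $0\le i\le\varphi(m)-1$, $$f_{m,p,i,0}=\Theta_i\,\Psi_m.$$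
   Context: $\Phi_n$ is the $n$-th cyclotomic polynomial, $\varphi$ is Euler's totient function, $\operatorname{rem}(a,b)$ is the remainder of polynomial division of $a$ by $b$, and $\Psi_m=(x^m-1)/\Phi_m$ is the $m$-th inverse cyclotomic polynomial. *)

theory Defs
  imports
    Complex_Main
    "HOL-Computational_Algebra.Computational_Algebra"
    "HOL-Number_Theory.Totient"
begin

definition primitive_roots_of_unity :: "nat \<Rightarrow> complex set" where
  "primitive_roots_of_unity n = {z. z ^ n = 1 \<and> (\<forall>k. 0 < k \<and> k < n \<longrightarrow> z ^ k \<noteq> 1)}"

(* Only meaningful for n > 0. The coefficients are integers, but the polynomials are taken over
   the field of complex numbers, so that the library's div and mod are available for them. As
   cyclotomic polynomials are monic, quotients and remainders on division by them do not depend
   on whether the division is carried out over the integers or over the complex numbers. *)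
definition cyclotomic :: "nat \<Rightarrow> complex poly" where
  "cyclotomic n = (\<Prod>z\<in>primitive_roots_of_unity n. [:- z, 1:])"

definition inverse_cyclotomic :: "nat \<Rightarrow> complex poly" where
  "inverse_cyclotomic m = (monom 1 m - 1) div cyclotomic m"

definition cyclotomic_w :: "nat \<Rightarrow> nat \<Rightarrow> complex poly" where
  "cyclotomic_w m i = - (\<Sum>s\<le>i. monom (coeff (cyclotomic m) s) (i - s))"

(* pcompose w (monom 1 k) is w(x^k) *)
definition cyclotomic_Theta :: "nat \<Rightarrow> nat \<Rightarrow> nat \<Rightarrow> complex poly" where
  "cyclotomic_Theta m r i = pcompose (cyclotomic_w m i) (monom 1 (m - r)) mod cyclotomic m"

end

(* Comparing roots gives Phi_mp Phi_m = Phi_m(x^p), hence (x^m - 1) Phi_mp = Psi_m Phi_m(x^p).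
   Put F = sum_{j<i} f_j x^(jp) and A = Psi_m sum_{s<=i} a_s x^(sp). Since p > m, modulo x^(ip+m)
   only F + x^(ip) f_{i,0} survives from Phi_mp and only A from the right-hand side; comparing
   degrees then gives the exact identity (x^m - 1) F = x^(ip) f_{i,0} + A. Reduce this modulo
   x^m - 1, where x^(m-r) is the inverse of x^p, to get f_{i,0} = w_i(x^(m-r)) Psi_m modulo
   Phi_m Psi_m, and conclude by deg f_{i,0} < m. *)
theory Submission
  imports Defs
begin

section \<open>Primitive roots of unity\<close>

text \<open>Reducing the exponent modulo \<open>n\<close> turns minimality of the order into a
  divisibility criterion, which is the form used to compare the orders of \<open>z\<close> and
  \<open>z ^ p\<close>.\<close>

lemma primitive_roots_of_unity_iff:
  assumes "n > 0"
  shows "z \<in> primitive_roots_of_unity n \<longleftrightarrow> (\<forall>k. z ^ k = 1 \<longleftrightarrow> n dvd k)"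
proof
  assume z: "z \<in> primitive_roots_of_unity n"
  show "\<forall>k. z ^ k = 1 \<longleftrightarrow> n dvd k"
  proof
    fix k
    have "z ^ k = z ^ (n * (k div n) + k mod n)" by simp
    also have "\<dots> = z ^ (k mod n)"
      using z unfolding power_add power_mult by (simp add: primitive_roots_of_unity_def)
    finally have "z ^ k = z ^ (k mod n)" .
    moreover have "k mod n < n" using assms by simp
    ultimately show "z ^ k = 1 \<longleftrightarrow> n dvd k"
      using z unfolding primitive_roots_of_unity_def by (auto simp: dvd_eq_mod_eq_0)
  qed
next
  assume "\<forall>k. z ^ k = 1 \<longleftrightarrow> n dvd k"
  then show "z \<in> primitive_roots_of_unity n"
    by (auto simp: primitive_roots_of_unity_def dest: dvd_imp_le)
qed

lemma finite_primitive_roots_of_unity: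
  assumes "n > 0"
  shows "finite (primitive_roots_of_unity n)"
  by (rule finite_subset[OF _ finite_nth_roots[OF assms, of 1]])
     (auto simp: primitive_roots_of_unity_def)

text \<open>The witness is exp(2 pi i / n). The lemma makes the degree of
  \<open>cyclotomic n\<close> positive, and so the degree of \<open>inverse_cyclotomic n\<close>
  less than \<open>n\<close>.\<close>

lemma primitive_roots_of_unity_nonempty:
  assumes "n > 0"
  shows "primitive_roots_of_unity n \<noteq> {}"
proof -
  let ?z = "cis (2 * pi * real 1 / real n)"
  have "?z ^ k \<noteq> 1" if "0 < k" "k < n" for k
  proof
    assume "?z ^ k = 1"
    \<comment> \<open>The value 1 is written as the root with index 0, so that injectivity of the
      indexing of the \<open>n\<close>-th roots of unity gives \<open>k = 0\<close>.\<close>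
    then have "cis (2 * pi * real k / real n) = cis (2 * pi * real 0 / real n)"
      by (simp add: Complex.DeMoivre mult_ac)
    with inj_onD[OF bij_betw_imp_inj_on[OF bij_betw_roots_unity[OF assms]], of k 0] that
    show False by simp
  qed
  moreover have "?z ^ n = 1" using assms by (simp add: Complex.DeMoivre)
  ultimately show ?thesis unfolding primitive_roots_of_unity_def by blast
qed

section \<open>Products of linear factors over a set of roots\<close>

text \<open>Splitting off the factor of one root leaves a quotient that still vanishes at the other
  roots, as these are distinct from it; hence the induction with \<open>P\<close> arbitrary.\<close>

lemma prod_linear_factors_dvd:
  fixes P :: "'a :: idom poly"
  assumes "finite A" and "\<And>z. z \<in> A \<Longrightarrow> poly P z = 0"
  shows "(\<Prod>z\<in>A. [:- z, 1:]) dvd P"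
  using assms
proof (induction A arbitrary: P rule: finite_induct)
  case (insert a A)
  obtain Q where Q: "P = [:- a, 1:] * Q"
    using insert.prems[of a] by (auto simp: poly_eq_0_iff_dvd elim: dvdE)
  have "poly Q z = 0" if "z \<in> A" for z
    using insert.prems[of z] insert.hyps that by (auto simp: Q)
  then have "(\<Prod>z\<in>A. [:- z, 1:]) dvd Q" by (rule insert.IH)
  then have "[:- a, 1:] * (\<Prod>z\<in>A. [:- z, 1:]) dvd P" unfolding Q by (rule mult_dvd_mono[OF dvd_refl])
  then show ?case using insert.hyps by simp
qed simp

lemma degree_monom_diff_const:
  fixes c :: "'a :: comm_ring_1"
  assumes "n > 0"
  shows "degree (monom 1 n - [:c:]) = n"
  unfolding diff_conv_add_uminus using assms
  by (subst degree_add_eq_left) (auto simp: degree_monom_eq)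

text \<open>Since \<open>c\<close> is nonzero, it has \<open>n\<close> distinct \<open>n\<close>-th
  roots. The product therefore divides the left-hand side with equal degree, and both are monic, so
  the quotient is 1.\<close>

lemma monom_diff_eq_prod_roots:
  fixes c :: complex
  assumes "n > 0" and "c \<noteq> 0"
  shows "monom 1 n - [:c:] = (\<Prod>z\<in>{z. z ^ n = c}. [:- z, 1:])"
proof -
  let ?P = "monom 1 n - [:c:]" and ?R = "\<Prod>z\<in>{z. z ^ n = c}. [:- z, 1:]"
  have degP: "degree ?P = n"
    using assms(1) by (rule degree_monom_diff_const)
  have degR: "degree ?R = n"
    using card_nth_roots[OF assms(2,1)] by (subst degree_prod_eq_sum_degree) auto
  have "lead_coeff ?R = 1" by (simp add: lead_coeff_prod)
  moreover have "lead_coeff ?P = 1"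
    unfolding degP using assms(1) by (auto simp: coeff_pCons split: nat.splits)
  moreover have "?R dvd ?P"
    by (rule prod_linear_factors_dvd[OF finite_nth_roots[OF assms(1)]]) (simp add: poly_monom)
  then obtain Q where Q: "?P = ?R * Q" by (elim dvdE)
  moreover from Q have "Q \<noteq> 0" using degP assms(1) by auto
  then have "degree Q = 0"
    using degP degR degree_mult_eq[of ?R Q] \<open>lead_coeff ?R = 1\<close> unfolding Q by fastforce
  then obtain d where d: "Q = [:d:]" by (elim degree_eq_zeroE)
  ultimately have "d = 1" by (metis lead_coeff_mult lead_coeff_pCons(2) mult_1)
  then show ?thesis using Q d by simp
qed

section \<open>Cyclotomic and inverse cyclotomic polynomials\<close>

lemma cyclotomic_dvd:
  assumes "n > 0"
  shows "cyclotomic n dvd monom 1 n - 1"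
  unfolding cyclotomic_def
  by (rule prod_linear_factors_dvd[OF finite_primitive_roots_of_unity[OF assms]])
     (simp add: poly_monom primitive_roots_of_unity_def)

lemma cyclotomic_mult_inverse_cyclotomic:
  assumes "n > 0"
  shows "cyclotomic n * inverse_cyclotomic n = monom 1 n - 1"
  using cyclotomic_dvd[OF assms] by (simp add: inverse_cyclotomic_def)

lemma cyclotomic_nonzero:
  assumes "n > 0"
  shows "cyclotomic n \<noteq> 0"
  using finite_primitive_roots_of_unity[OF assms] by (simp add: cyclotomic_def)

lemma degree_monom_minus_one:
  assumes "n > 0"
  shows "degree (monom 1 n - 1 :: complex poly) = n"
  using degree_monom_diff_const[OF assms, of "1 :: complex"] by (simp add: one_pCons)

lemma degree_inverse_cyclotomic_less:
  assumes "n > 0"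
  shows "degree (inverse_cyclotomic n) < n"
proof -
  have "degree (cyclotomic n) = card (primitive_roots_of_unity n)"
    unfolding cyclotomic_def by (subst degree_prod_eq_sum_degree) auto
  then have "degree (cyclotomic n) > 0"
    using finite_primitive_roots_of_unity[OF assms] primitive_roots_of_unity_nonempty[OF assms]
    by (simp add: card_gt_0_iff)
  moreover have "monom 1 n - 1 \<noteq> (0 :: complex poly)"
    using degree_monom_minus_one[OF assms] assms by auto
  then have "inverse_cyclotomic n \<noteq> 0"
    using cyclotomic_mult_inverse_cyclotomic[OF assms] by auto
  ultimately show ?thesis
    using degree_mult_eq[OF cyclotomic_nonzero[OF assms], of "inverse_cyclotomic n"] assms
    by (simp add: cyclotomic_mult_inverse_cyclotomic degree_monom_minus_one)
qed

section \<open>The relation between the polynomials of index m and mp\<close>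

text \<open>If \<open>z ^ p\<close> has order \<open>m\<close>, then the order of \<open>z\<close>
  is a multiple of \<open>m\<close> and divides \<open>m * p\<close>, hence is one of the two;
  whether \<open>z ^ m = 1\<close> decides which. Conversely, passing to \<open>z ^ p\<close>
  cancels the factor \<open>p\<close> from the order \<open>m * p\<close> and, by coprimality,
  preserves the order \<open>m\<close>.\<close>

lemma power_prime_in_primitive_roots_iff:
  assumes "m > 0" and "prime p" and "\<not> p dvd m"
  shows "z ^ p \<in> primitive_roots_of_unity m \<longleftrightarrow>
    z \<in> primitive_roots_of_unity (m * p) \<union> primitive_roots_of_unity m"
proof -
  have p0: "p > 0" using assms(2) prime_gt_0_nat by blast
  have cop: "coprime m p"
    using prime_imp_coprime[OF assms(2,3)] by (simp add: coprime_commute)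
  note iff = primitive_roots_of_unity_iff[OF assms(1)]
    primitive_roots_of_unity_iff[of "m * p", OF mult_pos_pos[OF assms(1) p0]]
  show ?thesis
  proof
    assume "z ^ p \<in> primitive_roots_of_unity m"
    then have zp: "z ^ (p * k) = 1 \<longleftrightarrow> m dvd k" for k by (simp add: iff power_mult)
    have m_dvd: "m dvd k" if "z ^ k = 1" for k
      using zp[of k] that by (simp add: power_mult mult.commute[of p])
    show "z \<in> primitive_roots_of_unity (m * p) \<union> primitive_roots_of_unity m"
    proof (cases "z ^ m = 1")
      case True
      then have "z ^ k = 1 \<longleftrightarrow> m dvd k" for k
        using m_dvd by (auto simp: power_mult elim!: dvdE)
      then show ?thesis by (simp add: iff)
    next
      case False
      have "z ^ k = 1 \<longleftrightarrow> m * p dvd k" for k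
      proof
        assume k: "z ^ k = 1"
        obtain j where j: "k = m * j" using m_dvd[OF k] by (elim dvdE)
        have "p dvd j"
        proof (rule ccontr)
          assume "\<not> p dvd j"
          then have "coprime j p" using prime_imp_coprime[OF assms(2)] by (simp add: coprime_commute)
          moreover have "j \<noteq> 0" using \<open>\<not> p dvd j\<close> by (metis dvd_0_right)
          \<comment> \<open>If \<open>p\<close> did not divide \<open>j\<close>, this Bezout
            relation would write \<open>z ^ m\<close> as a quotient of a power of
            \<open>z ^ k\<close> by a power of \<open>z ^ (p * m)\<close>, both equal to 1.\<close>
          ultimately obtain a b where ab: "j * a = p * b + 1"
            using bezout_nat[of j p] by auto
          have "1 = (z ^ k) ^ a" using k by simp
          also have "\<dots> = z ^ (m * (j * a))" by (simp add: j power_mult mult.assoc)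
          also have "\<dots> = z ^ (p * (m * b)) * z ^ m"
            unfolding ab by (simp add: power_add distrib_left mult_ac)
          also have "z ^ (p * (m * b)) = 1" using zp by simp
          finally show False using False by simp
        qed
        then show "m * p dvd k" by (simp add: j)
      next
        assume "m * p dvd k"
        then obtain j where "k = m * p * j" by (elim dvdE)
        then have "k = p * (m * j)" by (simp only: mult_ac)
        then show "z ^ k = 1" using zp by simp
      qed
      then show ?thesis by (simp add: iff)
    qed
  next
    assume "z \<in> primitive_roots_of_unity (m * p) \<union> primitive_roots_of_unity m"
    moreover have "m * p dvd p * k \<longleftrightarrow> m dvd k" for k using p0 by (simp add: mult.commute)
    moreover have "m dvd p * k \<longleftrightarrow> m dvd k" for k
      using cop by (simp add: coprime_dvd_mult_right_iff)
    ultimately show "z ^ p \<in> primitive_roots_of_unity m"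
      by (auto simp: iff power_mult[symmetric])
  qed
qed

text \<open>Substituting \<open>x^p\<close> turns each factor \<open>x - c\<close> into
  \<open>x^p - c\<close>, which splits over the \<open>p\<close>-th roots of \<open>c\<close>. These
  fibres of the \<open>p\<close>-th power map partition the disjoint union of the primitive roots of
  orders \<open>m * p\<close> and \<open>m\<close>.\<close>

lemma cyclotomic_mult_prime:
  assumes "m > 0" and "prime p" and "\<not> p dvd m"
  shows "cyclotomic (m * p) * cyclotomic m = pcompose (cyclotomic m) (monom 1 p)"
proof -
  have p0: "p > 0" and p1: "p > 1" using assms(2) prime_gt_0_nat prime_gt_1_nat by auto
  let ?A = "primitive_roots_of_unity m" and ?B = "primitive_roots_of_unity (m * p)"
  have fin: "finite ?A" "finite ?B"
    using assms(1) p0 by (simp_all add: finite_primitive_roots_of_unity)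
  have disj: "?B \<inter> ?A = {}"
    using assms(1) p1 by (auto simp: primitive_roots_of_unity_def)
  have "pcompose (cyclotomic m) (monom 1 p) = (\<Prod>c\<in>?A. monom 1 p - [:c:])"
    unfolding cyclotomic_def pcompose_prod by (rule prod.cong) (simp_all add: pcompose_pCons)
  also have "\<dots> = (\<Prod>c\<in>?A. \<Prod>z\<in>{z\<in>?B \<union> ?A. z ^ p = c}. [:- z, 1:])"
  proof (rule prod.cong[OF refl])
    fix c assume c: "c \<in> ?A"
    then have "c \<noteq> 0" using assms(1) by (auto simp: primitive_roots_of_unity_def power_0_left)
    moreover have "{z. z ^ p = c} = {z\<in>?B \<union> ?A. z ^ p = c}"
      using c power_prime_in_primitive_roots_iff[OF assms] by blast
    ultimately show "monom 1 p - [:c:] = (\<Prod>z\<in>{z\<in>?B \<union> ?A. z ^ p = c}. [:- z, 1:])"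
      using monom_diff_eq_prod_roots[OF p0] by simp
  qed
  also have "\<dots> = (\<Prod>z\<in>?B \<union> ?A. [:- z, 1:])"
    using fin power_prime_in_primitive_roots_iff[OF assms] by (intro prod.group) auto
  also have "\<dots> = cyclotomic (m * p) * cyclotomic m"
    unfolding cyclotomic_def by (rule prod.union_disjoint[OF fin(2,1) disj])
  finally show ?thesis by simp
qed

section \<open>Auxiliary facts on monomials\<close>

lemma pcompose_monom_monom:
  fixes c :: "'a :: comm_semiring_1"
  shows "pcompose (monom c n) (monom 1 k) = monom c (n * k)"
  by (induction n) (simp_all add: monom_Suc pcompose_pCons mult_monom monom_0)

text \<open>This upgrades a congruence modulo \<open>x^n\<close> to an equality when all degrees are
  below \<open>n\<close>.\<close>

lemma monom_dvd_imp_eq_0: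
  fixes P :: "'a :: comm_semiring_1 poly"
  assumes "monom 1 n dvd P" and "\<And>k. k \<ge> n \<Longrightarrow> coeff P k = 0"
  shows "P = 0"
proof (rule poly_eqI)
  fix k
  show "coeff P k = coeff 0 k"
    using assms by (cases "k < n") (simp_all add: monom_1_dvd_iff')
qed

lemma monom_minus_one_dvd:
  fixes n k :: nat
  shows "(monom 1 n - 1 :: 'a :: comm_ring_1 poly) dvd monom 1 (n * k) - 1"
proof -
  have "monom (1 :: 'a) (n * k) = monom 1 n ^ k" by (simp add: monom_power)
  then show ?thesis by (simp only: power_diff_1_eq dvd_triv_left)
qed

section \<open>The initial block of each coefficient polynomial\<close>

theorem mainTheorem3:
  fixes m p q r :: nat
    and f :: "nat \<Rightarrow> complex poly"
    and g :: "nat \<Rightarrow> nat \<Rightarrow> complex poly"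
  assumes "m > 0" and "prime p" and "p > m"
    and "q = p div m" and "r = p mod m"
    and "cyclotomic (m * p) = (\<Sum>i<totient m. f i * monom 1 (i * p))"
    and "\<And>i. i < totient m \<Longrightarrow> degree (f i) < p"
    and "\<And>i. i < totient m \<Longrightarrow> f i = (\<Sum>j\<le>q. g i j * monom 1 (j * m))"
    and "\<And>i j. i < totient m \<Longrightarrow> j \<le> q \<Longrightarrow> degree (g i j) < m"
  shows "\<forall>i<totient m. g i 0 = cyclotomic_Theta m r i * inverse_cyclotomic m"
proof (intro allI impI)
  fix i assume i: "i < totient m"
  define \<Phi> where "\<Phi> = cyclotomic m"
  define \<Psi> where "\<Psi> = inverse_cyclotomic m"
  define C :: "complex poly" where "C = monom 1 m - 1"
  define P where "P = cyclotomic (m * p)"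
  define G where "G = g i 0"
  define F where "F = (\<Sum>j<i. f j * monom 1 (j * p))"
  define A where "A = \<Psi> * (\<Sum>s\<le>i. monom (coeff \<Phi> s) (s * p))"
  define W where "W = pcompose (cyclotomic_w m i) (monom 1 (m - r))"
  have \<Phi>\<Psi>: "\<Phi> * \<Psi> = C"
    unfolding \<Phi>_def \<Psi>_def C_def by (rule cyclotomic_mult_inverse_cyclotomic) fact
  have "\<not> p dvd m" using assms(1,3) by (auto dest: dvd_imp_le)
  then have "P * \<Phi> = pcompose \<Phi> (monom 1 p)"
    unfolding P_def \<Phi>_def using assms(1,2) by (intro cyclotomic_mult_prime)
  then have CP: "C * P = \<Psi> * pcompose \<Phi> (monom 1 p)"
    by (simp add: \<Phi>\<Psi>[symmetric] mult_ac)

  let ?N = "i * p + m"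
  \<comment> \<open>This is where \<open>p > m\<close> enters: every block after the
    \<open>i\<close>-th starts at exponent \<open>?N\<close> or later.\<close>
  have N_le: "?N \<le> j * p" if "i < j" for j
  proof -
    have "?N \<le> Suc i * p" using assms(3) by simp
    also have "\<dots> \<le> j * p" using that by (intro mult_right_mono) auto
    finally show ?thesis .
  qed
  have monom_dvd: "monom 1 ?N dvd (monom 1 k :: complex poly)" if "?N \<le> k" for k
    using that by (simp add: monom_1_dvd_iff')
  have "monom 1 ?N dvd P - (F + monom 1 (i * p) * G)"
  proof -
    have "P = (\<Sum>j\<in>{..<i} \<union> insert i {i<..<totient m}. f j * monom 1 (j * p))"
      unfolding P_def assms(6) using i by (intro sum.cong) auto
    also have "\<dots> = F + (\<Sum>j\<in>insert i {i<..<totient m}. f j * monom 1 (j * p))"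
      unfolding F_def by (rule sum.union_disjoint) auto
    finally have "P = F + (f i * monom 1 (i * p) + (\<Sum>j\<in>{i<..<totient m}. f j * monom 1 (j * p)))"
      by simp
    moreover have "f i = G + (\<Sum>j\<in>{0<..q}. g i j * monom 1 (j * m))"
    proof -
      have "{..q} = insert 0 {0<..q}" by auto
      then show ?thesis unfolding assms(8)[OF i] G_def by simp
    qed
    ultimately have "P - (F + monom 1 (i * p) * G) =
        (\<Sum>j\<in>{0<..q}. g i j * monom 1 (i * p + j * m)) + (\<Sum>j\<in>{i<..<totient m}. f j * monom 1 (j * p))"
      by (simp add: algebra_simps sum_distrib_left mult_monom)
    also have "monom 1 ?N dvd \<dots>"
      using N_le by (intro dvd_add dvd_sum dvd_mult monom_dvd) auto
    finally show ?thesis .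
  qed
  moreover have "monom 1 ?N dvd \<Psi> * pcompose \<Phi> (monom 1 p) - A"
  proof -
    \<comment> \<open>The range is extended beyond the degree by zero coefficients so that it can be
      split at \<open>i\<close> without comparing \<open>i\<close> with
      \<open>degree \<Phi>\<close>.\<close>
    have "\<Phi> = (\<Sum>s\<le>i + degree \<Phi>. monom (coeff \<Phi> s) s)"
      by (rule poly_as_sum_of_monoms'[symmetric]) simp
    then have "pcompose \<Phi> (monom 1 p) = (\<Sum>s\<le>i + degree \<Phi>. monom (coeff \<Phi> s) (s * p))"
      by (metis (no_types, lifting) pcompose_sum pcompose_monom_monom sum.cong)
    also have "{..i + degree \<Phi>} = {..i} \<union> {i<..i + degree \<Phi>}" by auto
    also have "(\<Sum>s\<in>\<dots>. monom (coeff \<Phi> s) (s * p)) = (\<Sum>s\<le>i. monom (coeff \<Phi> s) (s * p)) +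
        (\<Sum>s\<in>{i<..i + degree \<Phi>}. monom (coeff \<Phi> s) (s * p))"
      by (rule sum.union_disjoint) auto
    finally have "\<Psi> * pcompose \<Phi> (monom 1 p) - A =
        \<Psi> * (\<Sum>s\<in>{i<..i + degree \<Phi>}. monom (coeff \<Phi> s) (s * p))"
      by (simp add: A_def algebra_simps)
    also have "monom 1 ?N dvd \<dots>"
      by (intro dvd_mult dvd_sum) (auto simp: monom_1_dvd_iff' dest!: N_le)
    finally show ?thesis .
  qed
  \<comment> \<open>Multiplying \<open>x^(ip) G\<close> by \<open>C\<close> also produces
    \<open>x^(ip+m) G\<close>. Being a multiple of the modulus it is removed here, which leaves only
    terms of degree below \<open>?N\<close>.\<close>
  ultimately have "monom 1 ?N dvd (\<Psi> * pcompose \<Phi> (monom 1 p) - A) - C * (P - (F + monom 1 (i * p) * G))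
      - monom 1 ?N * G"
    by (intro dvd_diff[OF dvd_diff[OF _ dvd_mult] dvd_triv_left])
  also have "(\<Psi> * pcompose \<Phi> (monom 1 p) - A) - C * (P - (F + monom 1 (i * p) * G)) - monom 1 ?N * G
      = monom 1 m * F - F - monom 1 (i * p) * G - A"
  proof -
    have "monom 1 ?N = monom 1 m * (monom 1 (i * p) :: complex poly)"
      by (simp add: mult_monom add.commute)
    then show ?thesis unfolding CP[symmetric] by (simp add: C_def algebra_simps)
  qed
  finally have "monom 1 ?N dvd monom 1 m * F - F - monom 1 (i * p) * G - A" .
  \<comment> \<open>\<open>F\<close> has degree below \<open>i * p\<close>, while \<open>G\<close>
    and \<open>\<Psi>\<close> have degree below \<open>m\<close>, so no term reaches exponent
    \<open>?N\<close>.\<close>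
  moreover have "coeff (monom 1 m * F - F - monom 1 (i * p) * G - A) k = 0" if k: "?N \<le> k" for k
  proof -
    have F0: "coeff F l = 0" if l: "i * p \<le> l" for l
    proof -
      have "coeff (f j * monom 1 (j * p)) l = 0" if j: "j < i" for j
      proof -
        have "Suc j * p \<le> i * p" using j by (intro mult_right_mono) auto
        then have "p \<le> l - j * p" using l by simp
        moreover have "degree (f j) < p" using assms(7) i j by simp
        ultimately show ?thesis
          by (simp add: coeff_monom_mult mult.commute[of "f j"] coeff_eq_0)
      qed
      then show ?thesis unfolding F_def coeff_sum by simp
    qed
    have "degree G < m" unfolding G_def using assms(9) i by simp
    then have "coeff (monom 1 (i * p) * G) k = 0"
      using k by (simp add: coeff_monom_mult coeff_eq_0)
    moreover have "coeff A k = 0"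
    proof -
      have "coeff (\<Psi> * monom (coeff \<Phi> s) (s * p)) k = 0" if "s \<le> i" for s
      proof -
        have "s * p \<le> i * p" using that by (rule mult_le_mono1)
        then have "m \<le> k - s * p" using k by linarith
        then have "coeff \<Psi> (k - s * p) = 0"
          using degree_inverse_cyclotomic_less[OF assms(1)]
          by (intro coeff_eq_0) (simp add: \<Psi>_def)
        then show ?thesis by (simp add: coeff_monom_mult mult.commute[of \<Psi>])
      qed
      then show ?thesis unfolding A_def sum_distrib_left coeff_sum by simp
    qed
    ultimately show ?thesis using k F0 by (simp add: coeff_monom_mult)
  qed
  ultimately have "monom 1 m * F - F - monom 1 (i * p) * G - A = 0"
    by (rule monom_dvd_imp_eq_0)
  then have key: "monom 1 (i * p) * G + A = C * F"
    by (simp add: C_def algebra_simps)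

  \<comment> \<open>The exponent sum is a multiple of \<open>m\<close>, so \<open>x^(m-r)\<close>
    inverts \<open>x^p\<close> modulo \<open>C\<close>; here \<open>r < m\<close> keeps the natural
    subtraction exact.\<close>
  have shift: "p + (m - r) = m * Suc q"
    using mult_div_mod_eq[of m p] mod_less_divisor[OF assms(1), of p] unfolding assms(4,5) mult_Suc_right
    by linarith
  have C_dvd: "C dvd monom 1 (s * (p + (m - r))) - 1" for s
    using monom_minus_one_dvd[of m "s * Suc q"] unfolding shift C_def by (simp only: mult_ac)
  have W: "W = - (\<Sum>s\<le>i. monom (coeff \<Phi> s) ((i - s) * (m - r)))"
    by (simp add: W_def cyclotomic_w_def \<Phi>_def pcompose_uminus pcompose_sum pcompose_monom_monom)
  \<comment> \<open>The identity \<open>key\<close> is multiplied by the inverse of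
    \<open>x^(ip)\<close>. The two subtracted terms replace each \<open>x^(s(p+m-r))\<close> by 1
    modulo \<open>C\<close>, which turns \<open>A\<close> into \<open>- \<Psi> * W\<close>.\<close>
  have "C dvd monom 1 (i * (m - r)) * (monom 1 (i * p) * G + A)
      - (monom 1 (i * (p + (m - r))) - 1) * G
      - \<Psi> * (\<Sum>s\<le>i. monom (coeff \<Phi> s) ((i - s) * (m - r)) * (monom 1 (s * (p + (m - r))) - 1))"
    unfolding key
    by (intro dvd_diff[OF dvd_diff[OF dvd_mult[OF dvd_triv_left] dvd_mult2] dvd_mult] C_dvd dvd_sum
        dvd_mult[OF C_dvd])
  also have "\<dots> = G - \<Psi> * W"
  proof -
    have "monom 1 (i * (m - r)) * monom (coeff \<Phi> s) (s * p)
        = monom (coeff \<Phi> s) ((i - s) * (m - r)) * monom 1 (s * (p + (m - r)))" if "s \<le> i" for s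
    proof -
      have "i * (m - r) = (i - s) * (m - r) + s * (m - r)"
        using that by (simp flip: add_mult_distrib)
      then show ?thesis by (simp add: mult_monom algebra_simps)
    qed
    then have "monom 1 (i * (m - r)) * A =
        \<Psi> * (\<Sum>s\<le>i. monom (coeff \<Phi> s) ((i - s) * (m - r)) * monom 1 (s * (p + (m - r))))"
      by (simp add: A_def sum_distrib_left mult.left_commute[of _ \<Psi>])
    moreover have "monom 1 (i * (m - r)) * monom 1 (i * p) = (monom 1 (i * (p + (m - r))) :: complex poly)"
      by (simp add: mult_monom distrib_left add.commute)
    ultimately show ?thesis
      unfolding W by (simp add: distrib_left mult.assoc[symmetric] left_diff_distrib
          right_diff_distrib sum_subtractf)
  qed
  finally have "G mod C = \<Psi> * W mod (\<Psi> * \<Phi>)"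
    unfolding mult.commute[of \<Psi> \<Phi>] \<Phi>\<Psi> by (simp add: mod_eq_dvd_iff)
  moreover have "G mod C = G"
    using assms(9)[OF i, of 0] degree_monom_minus_one[OF assms(1)]
    by (intro mod_poly_less) (simp add: G_def C_def)
  \<comment> \<open>The common factor \<open>\<Psi>\<close> comes out of the remainder, and what is
    left, \<open>W mod \<Phi>\<close>, is \<open>cyclotomic_Theta m r i\<close>.\<close>
  ultimately show "g i 0 = cyclotomic_Theta m r i * inverse_cyclotomic m"
    by (simp add: mod_mult_mult1 G_def W_def \<Phi>_def \<Psi>_def cyclotomic_Theta_def mult.commute)
qed

end
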